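(* For every integer $d\ge 1$ there is a constant $C_d$, depending only on $d$, such that for every integer $N\ge 3$ with smallest prime factor $p_1$ and every eigenvalue $\mu$ of $T^d_N$, one has $m_{T^d_N}(\mu)\le C_dN^{d/p_1}$. In particular, $m_{T^d_N}(\mu)\le C_dN^{d/2}$.
   Context: For integers $N\ge 3$ and $d\ge 1$, $T^d_N$ is the Cayley graph of $(\mathbb{Z}/N\mathbb{Z})^d$ with generating set $\{\pm e_1,\dots,\pm e_d\}$, $e_i$ being the canonical basis vectors. The eigenvalues of $T^d_N$ are those of its adjacency matrix, namely the numbers $\mu(k_1,\dots,k_d)=2\sum_{j=1}^d\cos\frac{2k_j\pi}{N}$ for $(k_1,\dots,k_d)\in(\mathbb{Z}/N\mathbb{Z})^d$. The multiplicity $m_{T^d_N}(\mu)$ is the number of tuples $(k_1,\dots,k_d)\in(\mathbb{Z}/N\mathbb{Z})^d$ with $\mu(k_1,\dots,k_d)=\mu$. *)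

theory Defs
  imports
    Complex_Main
    "HOL-Algebra.Product_Groups"
    "HOL-Library.Countable_Set"
    "HOL-Computational_Algebra.Primes"
    "Jordan_Normal_Form.Char_Poly"
begin

definition cayley_edges :: "('a, 'b) monoid_scheme \<Rightarrow> 'a set \<Rightarrow> ('a \<times> 'a) set" where
  "cayley_edges G S = {(x, x \<otimes>\<^bsub>G\<^esub> s) | x s. x \<in> carrier G \<and> s \<in> S}"

(* For finite V, from_nat_into V restricts to a bijection from {..<card V} onto V. Another
   enumeration of V conjugates the matrix by a permutation matrix, so the eigenvalues do not
   depend on this choice. *)
definition adjacency_mat :: "'a set \<Rightarrow> ('a \<times> 'a) set \<Rightarrow> real mat" where
  "adjacency_mat V E = mat (card V) (card V)
     (\<lambda>(i, j). if (from_nat_into V i, from_nat_into V j) \<in> E then 1 else 0)"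

(* The carrier consists of the functions on {1..d} with values in {0..<int N}
   that are extensional (undefined outside {1..d}). *)
definition torus_group :: "nat \<Rightarrow> nat \<Rightarrow> (nat \<Rightarrow> int) monoid" where
  "torus_group N d = product_group {1..d} (\<lambda>_. integer_mod_group N)"

definition basis_vec :: "nat \<Rightarrow> nat \<Rightarrow> nat \<Rightarrow> int" where
  "basis_vec d i = (\<lambda>j\<in>{1..d}. if j = i then 1 else 0)"

definition torus_gens :: "nat \<Rightarrow> nat \<Rightarrow> (nat \<Rightarrow> int) set" where
  "torus_gens N d = (\<Union>i\<in>{1..d}. {basis_vec d i, inv\<^bsub>torus_group N d\<^esub> (basis_vec d i)})"

definition torus_adjacency :: "nat \<Rightarrow> nat \<Rightarrow> real mat" where
  "torus_adjacency N d = adjacency_mat (carrier (torus_group N d))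
     (cayley_edges (torus_group N d) (torus_gens N d))"

definition torus_mu :: "nat \<Rightarrow> nat \<Rightarrow> (nat \<Rightarrow> int) \<Rightarrow> real" where
  "torus_mu N d k = 2 * (\<Sum>j = 1..d. cos (2 * real_of_int (k j) * pi / real N))"

definition torus_multiplicity :: "nat \<Rightarrow> nat \<Rightarrow> real \<Rightarrow> nat" where
  "torus_multiplicity N d \<mu> = card {k \<in> carrier (torus_group N d). torus_mu N d k = \<mu>}"

end

theory Submission
  imports Defs "HOL-Number_Theory.Cong"
begin

text \<open>
  Write \<open>e(k)\<close> for the root of unity \<open>exp (2 \<pi> i k / N)\<close>. For a fixed solution \<open>l\<close> of
  \<open>\<mu>(l) = \<mu>\<close>, any other solution \<open>k\<close> gives the vanishing sum
  \<open>\<Sum>j. e(k j) + e(- k j) - e(l j) - e(- l j) = 0\<close> with \<open>4 d\<close> terms. In the spirit of Mann's theorem,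
  a vanishing sum of at most \<open>m\<close> roots of unity splits into vanishing sums over the classes on which
  \<open>m! k\<close> is constant modulo \<open>N\<close>. A class that contains only terms \<open>e(k j)\<close> with positive sign is a
  vanishing sum of roots of unity without coefficients, so it has at least \<open>p\<^sub>1\<close> elements. Up to sign
  there are therefore at most \<open>d / p\<^sub>1\<close> such classes, each of which leaves one exponent free; all other
  exponents are determined up to boundedly many choices.

  The splitting rests on Galois conjugation \<open>e(k) \<mapsto> e(a k)\<close>, but only by multipliers \<open>a\<close> all of whose
  prime factors exceed \<open>m\<close>. For a prime \<open>p > m\<close> this needs no irreducibility theorem: if \<open>f(\<zeta>) = 0\<close>
  and \<open>f\<^sup>p = f(x\<^sup>p) + p g\<close>, then all conjugates of \<open>g(\<zeta>)\<close> have modulus less than \<open>1\<close>, whence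
  \<open>g(\<zeta>) = 0\<close>.
\<close>

section \<open>Galois conjugation of integer relations between roots of unity\<close>

definition int_poly_eval :: "int poly \<Rightarrow> complex \<Rightarrow> complex" where
  "int_poly_eval f z = poly (map_poly of_int f) z"

lemma int_poly_eval_simps [simp]:
  "int_poly_eval 0 z = 0" "int_poly_eval 1 z = 1"
  "int_poly_eval (f + g) z = int_poly_eval f z + int_poly_eval g z"
  "int_poly_eval (f - g) z = int_poly_eval f z - int_poly_eval g z"
  "int_poly_eval (f * g) z = int_poly_eval f z * int_poly_eval g z"
  "int_poly_eval (f ^ n) z = int_poly_eval f z ^ n"
  "int_poly_eval (pCons c f) z = of_int c + z * int_poly_eval f z"
  "int_poly_eval (monom c n) z = of_int c * z ^ n"
  "int_poly_eval (pcompose f g) z = int_poly_eval f (int_poly_eval g z)"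
  by (simp_all add: int_poly_eval_def of_int_poly_hom.hom_add of_int_poly_hom.hom_mult
      of_int_poly_hom.hom_minus of_int_poly_hom.hom_power of_int_hom.map_poly_pcompose of_int_hom.map_poly_pCons_hom
      poly_pcompose poly_monom map_poly_monom)

lemma int_poly_eval_prod:
  "int_poly_eval (\<Prod>i\<in>A. f i) z = (\<Prod>i\<in>A. int_poly_eval (f i) z)"
  by (induction A rule: infinite_finite_induct) auto

lemma int_poly_eval_sum:
  "int_poly_eval (\<Sum>i\<in>A. f i) z = (\<Sum>i\<in>A. int_poly_eval (f i) z)"
  by (induction A rule: infinite_finite_induct) auto

lemma int_poly_eval_cnj: "int_poly_eval f (cnj z) = cnj (int_poly_eval f z)"
  by (induction f) auto

section \<open>The Frobenius congruence for integer polynomials\<close>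

text \<open>All inner binomial coefficients are divisible by \<open>p\<close>. The ring is general
  because the congruence serves both integers and integer polynomials.\<close>

lemma prime_power_add_cong:
  fixes a b :: "'a :: comm_ring_1"
  assumes "prime p"
  shows "of_nat p dvd (a + b) ^ p - (a ^ p + b ^ p)"
proof -
  have p: "p > 0" "p > 1" using assms prime_gt_0_nat prime_gt_1_nat by auto
  have "(a + b) ^ p = (\<Sum>k\<le>p. of_nat (p choose k) * a ^ k * b ^ (p - k))"
    by (rule binomial_ring)
  also have "{..p} = insert 0 (insert p {1..<p})" using p by auto
  also have "(\<Sum>k\<in>\<dots>. of_nat (p choose k) * a ^ k * b ^ (p - k))
      = b ^ p + (a ^ p + (\<Sum>k\<in>{1..<p}. of_nat (p choose k) * a ^ k * b ^ (p - k)))"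
    using p by (subst sum.insert; simp)+
  finally have "(a + b) ^ p - (a ^ p + b ^ p)
      = (\<Sum>k\<in>{1..<p}. of_nat (p choose k) * a ^ k * b ^ (p - k))" by simp
  also have "of_nat p dvd \<dots>"
  proof (rule dvd_sum)
    fix k assume k: "k \<in> {1..<p}"
    have "p dvd (p choose k)" by (rule dvd_choose_prime) (use k assms in auto)
    then have "(of_nat p :: 'a) dvd of_nat (p choose k)" by auto
    then show "of_nat p dvd of_nat (p choose k) * a ^ k * b ^ (p - k)" by (simp add: mult.assoc)
  qed
  finally show ?thesis .
qed

text \<open>Fermat's little theorem, by induction through the additivity of the \<open>p\<close>-th
  power. Negative \<open>c\<close> is reduced to \<open>- c\<close> by expanding
  \<open>(c + (- c)) ^ p = 0\<close>, which treats \<open>p = 2\<close> along with the odd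
  primes.\<close>

lemma int_power_prime_cong:
  assumes "prime p"
  shows "int p dvd c ^ p - c"
proof -
  have nat: "int p dvd int n ^ p - int n" for n
  proof (induction n)
    case 0
    then show ?case using assms by (simp add: prime_gt_0_nat zero_power)
  next
    case (Suc n)
    have "int p dvd (int n + 1) ^ p - (int n ^ p + 1 ^ p)"
      using prime_power_add_cong[OF assms, of "int n" 1] by simp
    from dvd_add[OF this Suc] show ?case by (simp add: algebra_simps)
  qed
  show ?thesis
  proof (cases "c \<ge> 0")
    case True
    with nat[of "nat c"] show ?thesis by simp
  next
    case False
    have "int p dvd (c + (- c)) ^ p - (c ^ p + (- c) ^ p)"
      using prime_power_add_cong[OF assms, of "c" "-c"] by simp
    then have "int p dvd c ^ p + (-c) ^ p" using assms prime_gt_0_nat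
      by (simp add: zero_power) (metis add.commute dvd_minus_iff minus_add_distrib uminus_add_conv_diff)
    moreover have "int p dvd (-c) ^ p - (-c)" using nat[of "nat (-c)"] False by simp
    ultimately have "int p dvd (c ^ p + (-c) ^ p) - ((-c) ^ p - (-c))" by (rule dvd_diff)
    then show ?thesis by simp
  qed
qed

text \<open>Split off the constant term: additivity of the \<open>p\<close>-th power modulo
  \<open>p\<close> separates it from the rest, and Fermat's little theorem handles the constant
  itself.\<close>

lemma int_poly_power_prime:
  fixes f :: "int poly"
  assumes "prime p"
  shows "\<exists>g. f ^ p = pcompose f (monom 1 p) + of_nat p * g"
proof -
  have "of_nat p dvd f ^ p - pcompose f (monom 1 p)"
  proof (induction f)
    case 0
    then show ?case using assms by (simp add: prime_gt_0_nat zero_power)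
  next
    case (pCons c f)
    let ?x = "monom 1 1 :: int poly"
    have dec: "pCons c f = [:c:] + ?x * f" by (simp add: monom_altdef)
    have pw: "(?x * f) ^ p = monom 1 p * f ^ p" by (simp add: power_mult_distrib monom_power del: One_nat_def)
    obtain e where e: "c ^ p - c = int p * e" using int_power_prime_cong[OF assms, of c] by auto
    have const: "[:c:] ^ p - [:c:] = of_nat p * [:e:]"
    proof -
      have "[:c:] ^ p = [:c ^ p:]" by (simp add: poly_const_pow)
      moreover have "(of_nat p :: int poly) = [:int p:]" by (simp add: of_nat_poly)
      ultimately show ?thesis using e by simp
    qed
    have "(pCons c f) ^ p - pcompose (pCons c f) (monom 1 p)
       = (([:c:] + ?x * f) ^ p - ([:c:] ^ p + (?x * f) ^ p)) + ([:c:] ^ p - [:c:])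
        + monom 1 p * (f ^ p - pcompose f (monom 1 p))"
      by (subst dec) (simp only: pw, simp add: pcompose_pCons algebra_simps)
    also have "of_nat p dvd \<dots>"
      using pCons(2) by (intro dvd_add prime_power_add_cong[OF assms]) (simp_all only: const dvd_triv_left dvd_mult)
    finally show ?case .
  qed
  then show ?thesis by (metis diff_add_cancel dvdE add.commute)
qed

section \<open>Algebraic integers with small conjugates\<close>

text \<open>The integers are discrete. The index is asked to be positive because the vanishing of an
  \<open>n\<close>-th power gives that of its base only for \<open>n > 0\<close>.\<close>

lemma Ints_tendsto_0:
  fixes t :: "nat \<Rightarrow> complex"
  assumes "\<And>n. t n \<in> \<int>" "t \<longlonglongrightarrow> 0"
  shows "\<exists>n>0. t n = 0"
proof -
  have "eventually (\<lambda>n. norm (t n) < 1) sequentially"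
    using assms(2) by (simp add: tendsto_iff)
  moreover have "eventually (\<lambda>n::nat. n > 0) sequentially" by (rule eventually_gt_at_top)
  ultimately have "eventually (\<lambda>n. norm (t n) < 1 \<and> n > 0) sequentially" by eventually_elim auto
  then obtain n where n: "norm (t n) < 1" "n > 0" by (auto simp: eventually_sequentially)
  from assms(1)[of n] obtain k where "t n = of_int k" by (auto elim: Ints_cases)
  with n show ?thesis by auto
qed

locale primitive_root =
  fixes N :: nat and z :: complex
  assumes N_pos: "N > 0" and power_eq_1_iff: "z ^ k = 1 \<longleftrightarrow> N dvd k"
begin

lemma norm_z [simp]: "norm z = 1"
proof -
  have "z ^ N = 1" by (simp add: power_eq_1_iff)
  then have "norm z ^ N = 1" by (metis norm_one norm_power)
  then show ?thesis using N_pos power_eq_imp_eq_base[of "norm z" N 1] by simp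
qed

lemma z_nonzero: "z \<noteq> 0" using norm_z by force

lemma power_eqI: assumes "[i = j] (mod N)" shows "z ^ i = z ^ j"
proof -
  have *: "z ^ i = z ^ (i mod N)" for i
  proof -
    have "z ^ i = z ^ (N * (i div N) + i mod N)" by simp
    also have "\<dots> = z ^ (i mod N)" using power_eq_1_iff[of "N * (i div N)"]
      by (simp only: power_add) simp
    finally show ?thesis .
  qed
  show ?thesis using *[of i] *[of j] assms by (simp add: cong_def)
qed

text \<open>On roots of unity conjugation is inversion, hence a power map. This turns squared moduli
  into values of integer polynomials.\<close>

lemma cnj_power: "cnj (z ^ j) = (z ^ j) ^ (N - 1)"
proof -
  have "(z ^ j) * (z ^ j) ^ (N - 1) = (z ^ j) ^ N" using N_pos
    by (metis Suc_diff_1 power_Suc)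
  also have "\<dots> = 1" by (simp add: power_eq_1_iff flip: power_mult)
  finally have "(z ^ j) ^ (N - 1) = inverse (z ^ j)" using z_nonzero
    by (simp add: field_simps)
  also have "\<dots> = cnj (z ^ j)"
    by (simp add: norm_power inverse_eq_divide complex_div_cnj[of 1])
  finally show ?thesis by simp
qed

text \<open>Power sums over all \<open>N\<close>-th roots of unity are 0 or \<open>N\<close>.
  Summing over all of them, not only over the conjugates of \<open>z\<close>, keeps integrality
  elementary.\<close>

lemma trace_Ints: "(\<Sum>j\<in>{1..N}. int_poly_eval f (z ^ j)) \<in> \<int>"
proof -
  have mon: "(\<Sum>j\<in>{1..N}. (z ^ j) ^ i) \<in> \<int>" for i
  proof -
    let ?s = "\<Sum>j\<in>{1..N}. (z ^ i) ^ j"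
    have "z ^ i * ?s = (\<Sum>j\<in>{1..N}. (z ^ i) ^ Suc j)" by (simp add: sum_distrib_left)
    also have "\<dots> = (\<Sum>j\<in>{Suc 1..Suc N}. (z ^ i) ^ j)" by (rule sum.shift_bounds_cl_Suc_ivl[symmetric])
    also have "\<dots> = ?s + (z ^ i) ^ Suc N - z ^ i"
    proof -
      have "(\<Sum>j\<in>{1..Suc N}. (z ^ i) ^ j) = ?s + (z ^ i) ^ Suc N" by simp
      moreover have "(\<Sum>j\<in>{1..Suc N}. (z ^ i) ^ j) = z ^ i + (\<Sum>j\<in>{Suc 1..Suc N}. (z ^ i) ^ j)"
        by (subst sum.atLeast_Suc_atMost) auto
      ultimately show ?thesis by (simp add: algebra_simps)
    qed
    also have "(z ^ i) ^ Suc N = z ^ i" using power_eq_1_iff[of "i * N"] by (simp add: power_mult)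
    finally have "(z ^ i - 1) * ?s = 0" by (simp add: algebra_simps)
    then have "z ^ i = 1 \<or> ?s = 0" by auto
    then have "?s \<in> \<int>" by (auto simp: power_one)
    then show ?thesis by (simp add: mult.commute flip: power_mult)
  qed
  have "f = (\<Sum>i\<le>degree f. monom (coeff f i) i)" by (simp add: poly_as_sum_of_monoms)
  then have "int_poly_eval f w = int_poly_eval (\<Sum>i\<le>degree f. monom (coeff f i) i) w" for w
    by (rule arg_cong)
  then have "int_poly_eval f w = (\<Sum>i\<le>degree f. of_int (coeff f i) * w ^ i)" for w
    by (simp only: int_poly_eval_sum int_poly_eval_simps)
  then have "(\<Sum>j\<in>{1..N}. int_poly_eval f (z ^ j))
     = (\<Sum>j\<in>{1..N}. \<Sum>i\<le>degree f. of_int (coeff f i) * (z ^ j) ^ i)" by simp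
  also have "\<dots> = (\<Sum>i\<le>degree f. of_int (coeff f i) * (\<Sum>j\<in>{1..N}. (z ^ j) ^ i))"
    by (subst sum.swap) (simp add: sum_distrib_left)
  also have "\<dots> \<in> \<int>" by (intro Ints_sum Ints_mult mon) auto
  finally show ?thesis .
qed

text \<open>The exponents of the Galois conjugates of \<^term>\<open>z\<close>, described without field theory.\<close>

definition conjugate_exps :: "nat set" where
  "conjugate_exps = {j. \<forall>f. int_poly_eval f z = 0 \<longrightarrow> int_poly_eval f (z ^ j) = 0}"

lemma conjugate_exps_1: "1 \<in> conjugate_exps" by (simp add: conjugate_exps_def)

lemma conjugate_exps_mult:
  assumes "i \<in> conjugate_exps" "j \<in> conjugate_exps"
  shows "i * j \<in> conjugate_exps"
  unfolding conjugate_exps_def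
proof (safe)
  fix f assume "int_poly_eval f z = 0"
  then have "int_poly_eval (pcompose f (monom 1 i)) z = 0"
    using assms(1) by (simp add: conjugate_exps_def)
  then have "int_poly_eval (pcompose f (monom 1 i)) (z ^ j) = 0"
    using assms(2) by (auto simp: conjugate_exps_def simp del: int_poly_eval_simps)
  then show "int_poly_eval f (z ^ (i * j)) = 0" by (simp add: mult.commute flip: power_mult)
qed

lemma conjugate_exps_cong:
  assumes "[i = j] (mod N)" "i \<in> conjugate_exps" shows "j \<in> conjugate_exps"
  using assms power_eqI[OF assms(1)] by (simp add: conjugate_exps_def)

text \<open>Multiplication by \<open>i\<close> maps the finite set of conjugate exponents below
  \<open>N\<close> injectively into itself, so it is onto and reaches 1. The preimage of 1 is
  congruent to \<open>j\<close>.\<close>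

lemma conjugate_exps_inverse:
  assumes i: "i \<in> conjugate_exps" and ij: "[i * j = 1] (mod N)"
  shows "j \<in> conjugate_exps"
proof -
  let ?S = "conjugate_exps \<inter> {..<N}"
  let ?m = "\<lambda>x. (i * x) mod N"
  have "?m ` ?S \<subseteq> ?S"
  proof safe
    fix x assume "x \<in> conjugate_exps"
    then have "i * x \<in> conjugate_exps" by (rule conjugate_exps_mult[OF i])
    then show "?m x \<in> conjugate_exps" by (rule conjugate_exps_cong[rotated]) (simp add: cong_def)
  qed (use N_pos in auto)
  moreover have "inj_on ?m ?S"
  proof (rule inj_onI)
    fix x y assume xy: "x \<in> ?S" "y \<in> ?S" "?m x = ?m y"
    then have "[i * x = i * y] (mod N)" by (simp add: cong_def)
    then have "[j * (i * x) = j * (i * y)] (mod N)" by (rule cong_scalar_left)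
    then have "[(i * j) * x = (i * j) * y] (mod N)" by (simp add: ac_simps)
    moreover have "[(i * j) * x = 1 * x] (mod N)" "[(i * j) * y = 1 * y] (mod N)"
      using ij by (rule cong_scalar_right)+
    ultimately have "[1 * x = 1 * y] (mod N)" using cong_trans[OF cong_trans[OF cong_sym]] by blast
    then have "[x = y] (mod N)" by simp
    with xy show "x = y" by (auto simp: cong_def)
  qed
  ultimately have surj: "?m ` ?S = ?S" by (intro endo_inj_surj) auto
  have "1 mod N \<in> ?S" using conjugate_exps_cong[OF _ conjugate_exps_1, of "1 mod N"] N_pos
    by (simp add: cong_def)
  then have "1 mod N \<in> ?m ` ?S" by (simp only: surj)
  then obtain x where x: "x \<in> ?S" "1 mod N = ?m x" by (elim imageE)
  then have "[i * x = 1] (mod N)" by (simp add: cong_def)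
  then have "[j * (i * x) = j * 1] (mod N)" by (rule cong_scalar_left)
  moreover have "[(i * j) * x = 1 * x] (mod N)" using ij by (rule cong_scalar_right)
  moreover have "j * (i * x) = (i * j) * x" by simp
  ultimately have "[x = j] (mod N)"
    by (simp only: mult_1 mult_1_right) (rule cong_trans[OF cong_sym])
  with x show ?thesis using conjugate_exps_cong[of x j] by simp
qed

text \<open>If \<open>j\<close> has an inverse \<open>i\<close> modulo \<open>N\<close>, take a
  relation that holds at \<open>z\<close> but fails at \<open>z ^ i\<close>; composed with the
  \<open>i\<close>-th power it vanishes at \<open>z ^ j\<close> but not at \<open>z\<close>.
  Otherwise \<open>z ^ j\<close> has order less than \<open>N\<close>, which a polynomial of the
  form \<open>x ^ n - 1\<close> detects.\<close>

lemma separating_poly_single: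
  assumes "j \<notin> conjugate_exps"
  shows "\<exists>f. int_poly_eval f (z ^ j) = 0 \<and> int_poly_eval f z \<noteq> 0"
proof (cases "coprime j N")
  case True
  then obtain i where "[j * i = 1] (mod N)" using cong_solve_coprime_nat[of j N] by auto
  then have ij: "[i * j = 1] (mod N)" by (simp add: mult.commute)
  then have "i \<notin> conjugate_exps" using conjugate_exps_inverse assms by blast
  then obtain f where f: "int_poly_eval f z = 0" "int_poly_eval f (z ^ i) \<noteq> 0"
    by (auto simp: conjugate_exps_def)
  have "z ^ (j * i) = z ^ 1" using ij by (intro power_eqI) (simp add: mult.commute)
  then have "(z ^ j) ^ i = z" by (simp only: power_mult power_one_right)
  then have "int_poly_eval (pcompose f (monom 1 i)) (z ^ j) = 0"
    "int_poly_eval (pcompose f (monom 1 i)) z \<noteq> 0"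
    using f by (simp_all only: int_poly_eval_simps of_int_1 mult_1 not_False_eq_True)
  then show ?thesis by blast
next
  case False
  define g where "g = gcd j N"
  have "g \<noteq> 1" using False by (simp add: g_def coprime_iff_gcd_eq_1)
  moreover have "g > 0" using N_pos by (simp add: g_def)
  ultimately have "g > 1" by linarith
  then have g: "g dvd j" "g dvd N" "g > 1" by (simp_all add: g_def)
  have "N div g > 0" using g(2) N_pos dvd_imp_le[OF g(2)] g(3) by (simp add: div_greater_zero_iff)
  moreover have "N div g < N" using g(3) N_pos by (intro div_less_dividend)
  ultimately have "\<not> N dvd N div g" by (rule nat_dvd_not_less)
  moreover have "N dvd j * (N div g)"
  proof -
    obtain k where k: "j = g * k" using g(1) by (rule dvdE)
    have "j * (N div g) = k * (g * (N div g))" by (simp add: k)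
    also have "g * (N div g) = N" using g(2) by simp
    finally show ?thesis by simp
  qed
  ultimately have "z ^ (N div g) \<noteq> 1" "(z ^ j) ^ (N div g) = 1"
    by (simp_all only: power_eq_1_iff simp_thms flip: power_mult)
  then have "int_poly_eval (monom 1 (N div g) - 1) (z ^ j) = 0"
    "int_poly_eval (monom 1 (N div g) - 1) z \<noteq> 0" by simp_all
  then show ?thesis by blast
qed

lemma separating_poly:
  "\<exists>h. int_poly_eval h z \<noteq> 0 \<and> (\<forall>j\<in>{1..N}. j \<notin> conjugate_exps \<longrightarrow> int_poly_eval h (z ^ j) = 0)"
proof -
  obtain F where F: "\<And>j. j \<notin> conjugate_exps \<Longrightarrow>
      int_poly_eval (F j) (z ^ j) = 0 \<and> int_poly_eval (F j) z \<noteq> 0"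
    using separating_poly_single by metis
  define h where "h = (\<Prod>j\<in>{1..N} - conjugate_exps. F j)"
  have "int_poly_eval h z \<noteq> 0" using F by (simp add: h_def int_poly_eval_prod)
  moreover have "int_poly_eval h (z ^ j) = 0" if "j \<in> {1..N}" "j \<notin> conjugate_exps" for j
    unfolding h_def int_poly_eval_prod using F[of j] that by (intro prod_zero bexI[of _ j]) auto
  ultimately show ?thesis by blast
qed

text \<open>An algebraic integer with all conjugates inside the unit disc is 0. Weighted traces of
  high powers of its squared modulus are integers tending to 0, so one of them vanishes, and with it
  each of its nonnegative terms.\<close>

lemma eval_eq_0_of_conjugates_small:
  assumes small: "\<And>j. j \<in> conjugate_exps \<Longrightarrow> norm (int_poly_eval g (z ^ j)) < 1"
  shows "int_poly_eval g z = 0"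
proof -
  obtain h where h: "int_poly_eval h z \<noteq> 0"
    "\<And>j. j \<in> {1..N} \<Longrightarrow> j \<notin> conjugate_exps \<Longrightarrow> int_poly_eval h (z ^ j) = 0"
    using separating_poly by blast
  \<comment> \<open>On the \<open>N\<close>-th roots of unity \<open>c f\<close> takes the value of
    the squared modulus of \<open>f\<close>, while remaining an integer polynomial.\<close>
  define c where "c f = f * pcompose f (monom 1 (N - 1))" for f :: "int poly"
  have c: "int_poly_eval (c f) (z ^ j) = of_real (norm (int_poly_eval f (z ^ j)) ^ 2)" for f j
  proof -
    have "int_poly_eval (c f) (z ^ j) = int_poly_eval f (z ^ j) * int_poly_eval f (cnj (z ^ j))"
      unfolding cnj_power by (simp add: c_def)
    then show ?thesis by (simp only: int_poly_eval_cnj complex_norm_square)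
  qed
  \<comment> \<open>\<open>T n\<close> is an integer since it is a trace, and it tends to 0: the factor \<open>h\<close> removes the terms
    outside \<open>conjugate_exps\<close>, on which nothing is known about \<open>g\<close>.\<close>
  define T where "T n = (\<Sum>j\<in>{1..N}. int_poly_eval (c h * c g ^ n) (z ^ j))" for n
  define R where "R n = (\<Sum>j\<in>{1..N}. norm (int_poly_eval h (z ^ j)) ^ 2
       * (norm (int_poly_eval g (z ^ j)) ^ 2) ^ n)" for n
  have TR: "T n = of_real (R n)" for n by (simp add: T_def R_def c)
  have "R \<longlonglongrightarrow> (\<Sum>j\<in>{1..N}. 0)"
    unfolding R_def
  proof (rule tendsto_sum)
    fix j assume j: "j \<in> {1..N}"
    show "(\<lambda>n. norm (int_poly_eval h (z ^ j)) ^ 2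
       * (norm (int_poly_eval g (z ^ j)) ^ 2) ^ n) \<longlonglongrightarrow> 0"
    proof (cases "j \<in> conjugate_exps")
      case True
      then have "norm (int_poly_eval g (z ^ j)) ^ 2 < 1"
        using small by (simp add: abs_square_less_1)
      then have "(\<lambda>n. (norm (int_poly_eval g (z ^ j)) ^ 2) ^ n) \<longlonglongrightarrow> 0"
        by (intro LIMSEQ_realpow_zero) auto
      from tendsto_mult_right_zero[OF this] show ?thesis by simp
    next
      case False
      then show ?thesis using h(2) j by simp
    qed
  qed
  then have "(\<lambda>n. of_real (R n) :: complex) \<longlonglongrightarrow> of_real (\<Sum>j\<in>{1..N}. 0)" by (rule tendsto_of_real)
  moreover have "T = (\<lambda>n. of_real (R n))" using TR by (simp add: fun_eq_iff)
  ultimately have "T \<longlonglongrightarrow> 0" by simp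
  then obtain n where n: "n > 0" "T n = 0"
    using Ints_tendsto_0[of T] trace_Ints unfolding T_def by blast
  then have "R n = 0" by (simp add: TR)
  \<comment> \<open>All terms of \<open>R n\<close> are nonnegative; the term \<open>j = 1\<close>
    belongs to \<open>z\<close> itself, where \<open>h\<close> does not vanish.\<close>
  then have "norm (int_poly_eval h (z ^ 1)) ^ 2 * (norm (int_poly_eval g (z ^ 1)) ^ 2) ^ n = 0"
    unfolding R_def using N_pos by (subst (asm) sum_nonneg_eq_0_iff) (auto dest: bspec[of _ _ 1])
  then show ?thesis using h(1) by simp
qed

section \<open>Conjugation by multipliers without small prime factors\<close>

text \<open>At each conjugate of \<open>z\<close> the polynomial \<open>f\<close> vanishes, so
  \<open>p\<close> times the value of \<open>g\<close> is a value of \<open>- f\<close> on the unit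
  circle, of modulus at most \<open>m < p\<close>. The prime may divide \<open>N\<close>, in which
  case \<open>z ^ p\<close> is not a conjugate of \<open>z\<close>.\<close>

lemma galois_big_prime:
  assumes f: "int_poly_eval f z = 0" and p: "prime p" "real p > m"
    and bound: "\<And>w. norm w = 1 \<Longrightarrow> norm (int_poly_eval f w) \<le> m"
  shows "int_poly_eval f (z ^ p) = 0"
proof -
  obtain g where g: "f ^ p = pcompose f (monom 1 p) + of_nat p * g"
    using int_poly_power_prime[OF p(1)] by blast
  have ofn: "int_poly_eval (of_nat k) w = of_nat k" for k w by (induction k) auto
  have eq: "int_poly_eval f w ^ p = int_poly_eval f (w ^ p) + of_nat p * int_poly_eval g w" for w
    using arg_cong[OF g, of "\<lambda>q. int_poly_eval q w"] by (simp add: ofn)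
  have p0: "p > 0" using p(1) prime_gt_0_nat by blast
  have "int_poly_eval g z = 0"
  proof (rule eval_eq_0_of_conjugates_small)
    fix j assume "j \<in> conjugate_exps"
    then have "int_poly_eval f (z ^ j) = 0" using f by (simp add: conjugate_exps_def)
    then have "of_nat p * int_poly_eval g (z ^ j) = - int_poly_eval f ((z ^ j) ^ p)"
      using eq[of "z ^ j"] p0 by (simp add: zero_power eq_neg_iff_add_eq_0 add.commute)
    then have "real p * norm (int_poly_eval g (z ^ j)) = norm (int_poly_eval f ((z ^ j) ^ p))"
      by (metis norm_minus_cancel norm_mult norm_of_nat)
    also have "\<dots> \<le> m" by (rule bound) (simp add: norm_power)
    finally show "norm (int_poly_eval g (z ^ j)) < 1"
      using p(2) p0 mult_left_mono[of 1 "norm (int_poly_eval g (z ^ j))" "real p"] by fastforce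
  qed
  then show ?thesis using eq[of z] f p0 by (simp add: zero_power)
qed

text \<open>One prime factor of \<open>a\<close> is treated at a time. Composing \<open>f\<close>
  with a power map preserves the bound \<open>m\<close>, since the unit circle is mapped into
  itself.\<close>

lemma galois_rough:
  assumes f: "int_poly_eval f z = 0" and a: "a > 0" "\<And>p. prime p \<Longrightarrow> p dvd a \<Longrightarrow> real p > m"
    and bound: "\<And>w. norm w = 1 \<Longrightarrow> norm (int_poly_eval f w) \<le> m"
  shows "int_poly_eval f (z ^ a) = 0"
  using a
proof (induction a rule: prime_divisors_induct)
  case (factor p x)
  let ?g = "pcompose f (monom 1 x)"
  have "int_poly_eval f (z ^ x) = 0" using factor by auto
  then have "int_poly_eval ?g (z ^ p) = 0" using factor bound
    by (intro galois_big_prime[of ?g p m]) (auto simp: norm_power)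
  then show ?case by (simp flip: power_mult)
qed (use f in auto)

end

section \<open>Vanishing sums of roots of unity\<close>

text \<open>Integer exponents accommodate both \<open>k j\<close> and \<open>- k j\<close>; the
  explicit modulus allows the descent from \<open>N\<close> to a divisor of
  \<open>N\<close>.\<close>

definition unity_root :: "nat \<Rightarrow> int \<Rightarrow> complex" where
  "unity_root N k = cis (2 * pi * of_int k / of_nat N)"

lemma unity_root_add: "unity_root N (j + k) = unity_root N j * unity_root N k"
  by (simp add: unity_root_def cis_mult distrib_left add_divide_distrib)

lemma unity_root_power: "unity_root N k ^ n = unity_root N (int n * k)"
  by (simp add: unity_root_def DeMoivre mult_ac)

lemma norm_unity_root [simp]: "norm (unity_root N k) = 1"
  by (simp add: unity_root_def)

lemma unity_root_nonzero [simp]: "unity_root N k \<noteq> 0"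
  using norm_unity_root[of N k] by force

lemma unity_root_mult_left:
  assumes "p > 0" shows "unity_root (p * N) (int p * k) = unity_root N k"
  using assms by (simp add: unity_root_def mult.assoc)

lemma unity_root_eq_1_iff:
  assumes "N > 0" shows "unity_root N k = 1 \<longleftrightarrow> int N dvd k"
proof -
  have "unity_root N k = 1 \<longleftrightarrow> (\<exists>n. 2 * pi * of_int k / of_nat N = of_int n * (2 * pi))"
  proof
    assume "unity_root N k = 1"
    then have "cos (2 * pi * of_int k / of_nat N) = 1"
      by (simp add: unity_root_def complex_eq_iff)
    then show "\<exists>n. 2 * pi * of_int k / of_nat N = of_int n * (2 * pi)"
      by (simp add: cos_one_2pi_int mult_ac)
  next
    assume "\<exists>n. 2 * pi * of_int k / of_nat N = of_int n * (2 * pi)"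
    then obtain n where "2 * pi * of_int k / of_nat N = 2 * pi * of_int n" by (auto simp: mult_ac)
    then show "unity_root N k = 1" by (simp add: unity_root_def cis_multiple_2pi)
  qed
  also have "\<dots> \<longleftrightarrow> (\<exists>n. real_of_int k = of_int (int N * n))"
    using assms by (intro ex_cong1) (auto simp: field_simps)
  also have "\<dots> \<longleftrightarrow> int N dvd k" by (simp only: of_int_eq_iff dvd_def)
  finally show ?thesis .
qed

lemma unity_root_cong:
  assumes "N > 0" "[j = k] (mod int N)" shows "unity_root N j = unity_root N k"
proof -
  have "unity_root N j = unity_root N k * unity_root N (j - k)"
    by (simp flip: unity_root_add)
  also have "unity_root N (j - k) = 1"
    using assms by (simp add: unity_root_eq_1_iff cong_iff_dvd_diff)
  finally show ?thesis by simp
qed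

lemma primitive_root_unity_root: "N > 0 \<Longrightarrow> primitive_root N (unity_root N 1)"
  by unfold_locales (auto simp: unity_root_power unity_root_eq_1_iff)

lemma unity_root_sum_galois:
  fixes c :: "'i \<Rightarrow> int" and m :: nat
  assumes N: "N > 0" and sum0: "(\<Sum>i\<in>I. of_int (c i) * unity_root N (k i)) = 0"
    and c: "(\<Sum>i\<in>I. \<bar>c i\<bar>) \<le> int m"
    and a: "a > 0" "\<And>p. prime p \<Longrightarrow> p dvd a \<Longrightarrow> p > m"
  shows "(\<Sum>i\<in>I. of_int (c i) * unity_root N (int a * k i)) = 0"
proof -
  interpret primitive_root N "unity_root N 1" by (rule primitive_root_unity_root[OF N])
  \<comment> \<open>Reduction modulo \<open>N\<close> makes the exponents natural numbers, so that
    the sum is the value of an integer polynomial; its absolute coefficients bound it on the unit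
    circle.\<close>
  define e where "e i = nat (k i mod int N)" for i
  define f where "f = (\<Sum>i\<in>I. monom (c i) (e i))"
  have eval: "int_poly_eval f w = (\<Sum>i\<in>I. of_int (c i) * w ^ e i)" for w
    by (simp add: f_def int_poly_eval_sum)
  have pow: "(unity_root N 1 ^ b) ^ e i = unity_root N (int b * k i)" for b i
  proof -
    have "(unity_root N 1 ^ b) ^ e i = unity_root N (int b * (k i mod int N))"
      using N by (simp add: unity_root_power e_def mult_ac)
    also have "\<dots> = unity_root N (int b * k i)"
      by (rule unity_root_cong[OF N]) (simp add: cong_def mod_mult_right_eq)
    finally show ?thesis .
  qed
  have "int_poly_eval f (unity_root N 1 ^ 1) = 0"
    by (simp only: eval pow) (use sum0 in simp)
  then have "int_poly_eval f (unity_root N 1 ^ a) = 0"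
  proof (intro galois_rough[of f a "real m"])
    fix w :: complex assume w: "norm w = 1"
    have "norm (int_poly_eval f w) \<le> (\<Sum>i\<in>I. norm (of_int (c i) * w ^ e i))"
      unfolding eval by (rule norm_sum)
    also have "\<dots> = of_int (\<Sum>i\<in>I. \<bar>c i\<bar>)" by (simp add: norm_mult norm_power w)
    also have "\<dots> \<le> of_int (int m)" using c by (simp only: of_int_le_iff)
    finally show "norm (int_poly_eval f w) \<le> real m" by simp
  qed (use a in auto)
  then show ?thesis by (simp only: eval pow)
qed

section \<open>Splitting vanishing sums by classes of exponents\<close>

lemma sum_unity_root_powers:
  assumes "p > 0"
  shows "(\<Sum>t<p. unity_root p (int t * k)) = (if int p dvd k then of_nat p else 0)"
proof -
  have "(\<Sum>t<p. unity_root p (int t * k)) = (\<Sum>t<p. unity_root p k ^ t)"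
    by (simp add: unity_root_power)
  also have "\<dots> = (if int p dvd k then of_nat p else 0)"
  proof (cases "int p dvd k")
    case True
    then have "unity_root p k = 1" using assms unity_root_eq_1_iff by blast
    then show ?thesis using True by simp
  next
    case False
    then have "unity_root p k \<noteq> 1" using assms unity_root_eq_1_iff by blast
    moreover have "unity_root p k ^ p = 1"
      using assms by (simp add: unity_root_power unity_root_eq_1_iff)
    ultimately show ?thesis using False by (simp add: geometric_sum)
  qed
  finally show ?thesis .
qed

text \<open>The condition on \<open>p\<close> keeps primes \<open>q \<le> m\<close> from dividing
  the multipliers \<open>1 + t * N' * Q\<close>: such a \<open>q\<close> divides \<open>Q\<close> if
  it differs from \<open>p\<close>, and \<open>p \<le> m\<close> divides \<open>N'\<close> because
  then \<open>p ^ 2\<close> divides \<open>N\<close>. For \<open>p > m\<close> a multiplier may be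
  divisible by \<open>p\<close>, which the conjugation lemma permits, so all \<open>t < p\<close>
  are available.\<close>

lemma unity_root_sum_residue_class:
  fixes c :: "'i \<Rightarrow> int" and m :: nat
  assumes N: "N > 0" and fin: "finite I"
    and sum0: "(\<Sum>i\<in>I. of_int (c i) * unity_root N (k i)) = 0"
    and c: "(\<Sum>i\<in>I. \<bar>c i\<bar>) \<le> int m"
    and p: "prime p" "p dvd N" "p ^ 2 dvd N \<or> p > m"
  shows "(\<Sum>i\<in>{i\<in>I. k i mod int p = s}. of_int (c i) * unity_root N (k i)) = 0"
proof (cases "s mod int p = s")
  case False
  then have "{i\<in>I. k i mod int p = s} = {}" by auto
  then show ?thesis by (simp only: sum.empty)
next
  case s: True
  have p0: "p > 0" using p(1) prime_gt_0_nat by blast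
  define Q where "Q = (\<Prod>q\<in>{q. prime q \<and> q \<le> m \<and> q \<noteq> p}. q)"
  have finQ: "finite {q. prime q \<and> q \<le> m \<and> q \<noteq> p}" by (rule finite_subset[of _ "{..m}"]) auto
  have Q_dvd: "q dvd Q" if "prime q" "q \<le> m" "q \<noteq> p" for q
    unfolding Q_def using that finQ by (intro dvd_prodI) auto
  have "\<not> p dvd Q"
  proof
    assume "p dvd Q"
    then obtain q where "prime q" "q \<noteq> p" "p dvd q"
      unfolding Q_def using prime_dvd_prod_iff[OF finQ p(1)] by auto
    then show False using p(1) primes_dvd_imp_eq by blast
  qed
  then have "\<not> int p dvd int Q" by simp
  \<comment> \<open>\<open>Q\<close> is invertible modulo \<open>p\<close>, so its presence in the
    exponents does not change which residue class is detected.\<close>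
  then have p_dvd: "int p dvd int Q * y \<longleftrightarrow> int p dvd y" for y
    using p(1) by (simp add: prime_dvd_mult_iff)
  define N' where "N' = N div p"
  have N': "N = p * N'" using p by (simp add: N'_def)
  \<comment> \<open>The multipliers \<open>1 + t N' Q\<close> multiply \<open>e(k)\<close> by the \<open>p\<close>-th root of unity \<open>e(t N' Q k)\<close>, so
    that summing over \<open>t < p\<close> with suitable weights isolates a residue class modulo \<open>p\<close>.\<close>
  have galois: "(\<Sum>i\<in>I. of_int (c i) * unity_root N (int (1 + t * N' * Q) * k i)) = 0" for t
  proof (rule unity_root_sum_galois[OF N sum0 c])
    fix q assume q: "prime q" "q dvd 1 + t * N' * Q"
    show "q > m"
    proof (rule ccontr)
      assume "\<not> q > m"
      moreover have "q dvd N'" if "q = p" "p \<le> m"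
        using p that N' p0 by (auto simp: power2_eq_square)
      ultimately have "q dvd t * N' * Q" using Q_dvd[of q] q(1) by (cases "q = p") auto
      then have "q dvd 1" using q(2) by (metis dvd_add_left_iff)
      then show False using q(1) by simp
    qed
  qed simp
  have root: "unity_root N (int (1 + t * N' * Q) * k i) * unity_root p (int t * (int Q * (- s)))
     = unity_root N (k i) * unity_root p (int t * (int Q * (k i - s)))" for t i
  proof -
    have "int (1 + t * N' * Q) * k i = k i + int N' * (int t * (int Q * k i))"
      by (simp add: algebra_simps)
    moreover have "unity_root N (int N' * (int t * (int Q * k i))) = unity_root p (int t * (int Q * k i))"
      using unity_root_mult_left[of N' p] N N' by (simp only: mult.commute[of p]) simp
    moreover have "int t * (int Q * (k i - s)) = int t * (int Q * k i) + int t * (int Q * (- s))"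
      by (simp add: algebra_simps)
    ultimately show ?thesis by (simp only: unity_root_add mult.assoc)
  qed
  have "0 = (\<Sum>t<p. (\<Sum>i\<in>I. of_int (c i) * unity_root N (int (1 + t * N' * Q) * k i))
        * unity_root p (int t * (int Q * (- s))))"
    by (simp only: galois) simp
  also have "\<dots> = (\<Sum>t<p. \<Sum>i\<in>I. of_int (c i) * (unity_root N (int (1 + t * N' * Q) * k i)
        * unity_root p (int t * (int Q * (- s)))))"
    by (simp only: sum_distrib_right mult.assoc)
  also have "\<dots> = (\<Sum>t<p. \<Sum>i\<in>I. of_int (c i) *
      (unity_root N (k i) * unity_root p (int t * (int Q * (k i - s)))))"
    by (simp only: root)
  also have "\<dots> = (\<Sum>i\<in>I. \<Sum>t<p. of_int (c i) *
      (unity_root N (k i) * unity_root p (int t * (int Q * (k i - s)))))"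
    by (rule sum.swap)
  also have "\<dots> = (\<Sum>i\<in>I. of_int (c i) * unity_root N (k i) *
      (\<Sum>t<p. unity_root p (int t * (int Q * (k i - s)))))"
    by (simp only: sum_distrib_left mult.assoc)
  also have "\<dots> = (\<Sum>i\<in>I. of_int (c i) * unity_root N (k i) *
      (if k i mod int p = s then of_nat p else 0))"
    using s by (simp only: sum_unity_root_powers[OF p0] p_dvd) (simp add: mod_eq_dvd_iff[symmetric])
  also have "\<dots> = (\<Sum>i\<in>I. if k i mod int p = s then of_nat p * (of_int (c i) * unity_root N (k i)) else 0)"
    by (intro sum.cong) auto
  also have "\<dots> = of_nat p * (\<Sum>i\<in>{i\<in>I. k i mod int p = s}. of_int (c i) * unity_root N (k i))"
    using fin by (simp add: sum.inter_filter[symmetric] sum_distrib_left)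
  finally show ?thesis using p0 by simp
qed

text \<open>Such an \<open>N\<close> is a product of distinct primes up to \<open>m\<close>. It is
  the modulus at which the descent below stops, and the origin of the factorial there.\<close>

lemma dvd_fact_if_squarefree_smooth:
  fixes N m :: nat
  assumes N: "N > 0" and small: "\<And>p. prime p \<Longrightarrow> p dvd N \<Longrightarrow> \<not> p ^ 2 dvd N \<and> p \<le> m"
  shows "N dvd fact m"
proof (rule multiplicity_le_imp_dvd)
  fix p :: nat assume p: "prime p"
  show "multiplicity p N \<le> multiplicity p (fact m)"
  proof (cases "p dvd N")
    case True
    have "multiplicity p N < 2"
      using small[OF p True] N p
      by (metis multiplicity_dvd' not_le)
    moreover have "p dvd fact m" using small[OF p True] p prime_dvd_fact_iff by blast
    then have "multiplicity p (fact m) \<ge> 1"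
      using p prime_gt_1_nat[OF p] power_dvd_iff_le_multiplicity[of "fact m" p 1] by simp
    ultimately show ?thesis by linarith
  qed (simp add: not_dvd_imp_multiplicity_0)
qed (use N in auto)

text \<open>Descent on \<open>N\<close>. If some prime \<open>p\<close> admits splitting by residues
  modulo \<open>p\<close>, each residue class, after removal of a common root of unity, is a
  vanishing sum for the modulus \<open>N / p\<close>. If none does, \<open>N\<close> divides
  \<open>m!\<close> and thus \<open>L\<close>, and the class is everything or empty.\<close>

lemma unity_root_sum_scaled_class:
  fixes c :: "'i \<Rightarrow> int" and m :: nat and L :: int
  assumes L: "fact m dvd L" 
  assumes "N > 0" "finite I" "(\<Sum>i\<in>I. of_int (c i) * unity_root N (k i)) = 0"
    "(\<Sum>i\<in>I. \<bar>c i\<bar>) \<le> int m"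
  shows "(\<Sum>i\<in>{i\<in>I. [L * k i = x] (mod int N)}. of_int (c i) * unity_root N (k i)) = 0"
  using assms(2-)
proof (induction N arbitrary: I k x rule: less_induct)
  case (less N)
  note N = less.prems(1) and fin = less.prems(2) and sum0 = less.prems(3) and c = less.prems(4)
  show ?case
  proof (cases "\<exists>p. prime p \<and> p dvd N \<and> (p ^ 2 dvd N \<or> p > m)")
    case False
    have "N dvd fact m" using False N by (intro dvd_fact_if_squarefree_smooth) (auto simp: not_less)
    then have "int N dvd fact m" by (metis of_nat_dvd_iff of_nat_fact)
    then have "int N dvd L" using L dvd_trans by blast
    then have "[L * k i = 0] (mod int N)" for i by (simp add: cong_0_iff)
    then have *: "[L * k i = x] (mod int N) \<longleftrightarrow> [0 = x] (mod int N)" for i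
      by (meson cong_sym cong_trans)
    show ?thesis using sum0 by (cases "[0 = x] (mod int N)") (simp_all only: * simp_thms Collect_mem_eq empty_def[symmetric] sum.empty)
  next
    case True
    then obtain p where p: "prime p" "p dvd N" "p ^ 2 dvd N \<or> p > m" by blast
    have p1: "p > 1" using p(1) prime_gt_1_nat by blast
    obtain N' where N': "N = p * N'" using p(2) by (rule dvdE)
    have N'0: "N' > 0" "N' < N" using N p1 N' by auto
    define J where "J s = {i\<in>I. k i mod int p = s}" for s
    define k' where "k' i = k i div int p" for i
    have k: "k i = s + int p * k' i" if "i \<in> J s" for i s
      using that by (auto simp: J_def k'_def)
    have root: "unity_root N (k i) = unity_root N s * unity_root N' (k' i)" if "i \<in> J s" for i s
      using k[OF that] p1 by (simp add: unity_root_add N' unity_root_mult_left)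
    have zero: "(\<Sum>i\<in>J s. of_int (c i) * unity_root N' (k' i)) = 0" for s
    proof -
      have "0 = (\<Sum>i\<in>J s. of_int (c i) * unity_root N (k i))"
        unfolding J_def using unity_root_sum_residue_class[OF N fin sum0 c p] by simp
      also have "\<dots> = (\<Sum>i\<in>J s. unity_root N s * (of_int (c i) * unity_root N' (k' i)))"
        by (intro sum.cong refl) (simp add: root)
      finally show ?thesis by (simp flip: sum_distrib_left)
    qed
    have IH: "(\<Sum>i\<in>{i\<in>J s. [L * k' i = y] (mod int N')}. of_int (c i) * unity_root N' (k' i)) = 0" for s y
    proof (rule less.IH[OF N'0(2) N'0(1) _ zero])
      show "finite (J s)" using fin by (simp add: J_def)
      have "(\<Sum>i\<in>J s. \<bar>c i\<bar>) \<le> (\<Sum>i\<in>I. \<bar>c i\<bar>)"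
        using fin by (intro sum_mono2) (auto simp: J_def)
      then show "(\<Sum>i\<in>J s. \<bar>c i\<bar>) \<le> int m" using c by linarith
    qed
    \<comment> \<open>On \<open>J s\<close> the congruence modulo \<open>N\<close> can be divided by
      \<open>p\<close>, giving one modulo \<open>N'\<close>, if \<open>p\<close> divides
      \<open>x - L * s\<close>; otherwise it has no solution.\<close>
    have part: "(\<Sum>i\<in>{i\<in>J s. [L * k i = x] (mod int N)}. of_int (c i) * unity_root N (k i)) = 0" for s
    proof (cases "int p dvd x - L * s")
      case True
      then obtain y where y: "x - L * s = int p * y" by (rule dvdE)
      have "[L * k i = x] (mod int N) \<longleftrightarrow> [L * k' i = y] (mod int N')" if "i \<in> J s" for i
      proof -
        have "L * k i - x = int p * (L * k' i - y)" using y k[OF that] by (simp add: algebra_simps)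
        then show ?thesis using p1 by (simp add: cong_iff_dvd_diff N')
      qed
      then have "(\<Sum>i\<in>{i\<in>J s. [L * k i = x] (mod int N)}. of_int (c i) * unity_root N (k i))
         = (\<Sum>i\<in>{i\<in>J s. [L * k' i = y] (mod int N')}. unity_root N s * (of_int (c i) * unity_root N' (k' i)))"
        by (intro sum.cong) (auto simp: root)
      then show ?thesis by (simp add: IH flip: sum_distrib_left)
    next
      case False
      have "\<not> [L * k i = x] (mod int N)" if "i \<in> J s" for i
      proof
        assume "[L * k i = x] (mod int N)"
        then have "int p * int N' dvd L * k i - x" by (simp add: cong_iff_dvd_diff N')
        then have "int p dvd L * k i - x" by (rule dvd_mult_left)
        moreover have "x - L * s = int p * (L * k' i) - (L * k i - x)" using k[OF that]
          by (simp add: algebra_simps)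
        ultimately have "int p dvd x - L * s" by (metis dvd_diff dvd_triv_left)
        with False show False ..
      qed
      then have "{i\<in>J s. [L * k i = x] (mod int N)} = {}" by blast
      then show ?thesis by (simp only: sum.empty)
    qed
    let ?K = "{i\<in>I. [L * k i = x] (mod int N)}"
    have "(\<Sum>i\<in>?K. of_int (c i) * unity_root N (k i))
       = (\<Sum>s\<in>{0..<int p}. \<Sum>i\<in>{i\<in>?K. k i mod int p = s}. of_int (c i) * unity_root N (k i))"
      using fin p1 by (intro sum.group[symmetric]) auto
    also have "\<dots> = (\<Sum>s\<in>{0..<int p}. \<Sum>i\<in>{i\<in>J s. [L * k i = x] (mod int N)}. of_int (c i) * unity_root N (k i))"
      by (intro sum.cong refl) (auto simp: J_def)
    also have "\<dots> = 0" by (simp add: part)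
    finally show ?thesis .
  qed
qed

text \<open>If all prime factors of \<open>N\<close> exceeded \<open>card I\<close>, its factorial
  would be invertible modulo \<open>N\<close>. A class of the splitting would then consist of equal
  roots of unity, whose sum is nonzero.\<close>

lemma unity_root_sum_eq_0_imp_prime_le_card:
  assumes N: "N > 0" and I: "finite I" "I \<noteq> {}" and sum0: "(\<Sum>i\<in>I. unity_root N (k i)) = 0"
  shows "\<exists>p. prime p \<and> p dvd N \<and> p \<le> card I"
proof (rule ccontr)
  assume *: "\<nexists>p. prime p \<and> p dvd N \<and> p \<le> card I"
  obtain j where j: "j \<in> I" using I by blast
  have "coprime (fact (card I)) N"
  proof (rule ccontr)
    assume "\<not> coprime (fact (card I)) N"
    then have "gcd (fact (card I)) N \<noteq> 1" by (simp add: coprime_iff_gcd_eq_1)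
    then obtain p where "prime p" "p dvd gcd (fact (card I)) N" using prime_factor_nat by blast
    with * show False by (auto simp: prime_dvd_fact_iff)
  qed
  then have cop: "coprime (fact (card I) :: int) (int N)"
    by (metis coprime_int_iff of_nat_fact)
  let ?J = "{i\<in>I. [fact (card I) * k i = fact (card I) * k j] (mod int N)}"
  have "(\<Sum>i\<in>?J. of_int 1 * unity_root N (k i)) = 0"
    by (rule unity_root_sum_scaled_class[where m = "card I"]) (use N I sum0 in auto)
  moreover have "unity_root N (k i) = unity_root N (k j)" if "i \<in> ?J" for i
    using that cop by (intro unity_root_cong[OF N]) (auto simp: cong_mult_lcancel)
  ultimately have "of_nat (card ?J) * unity_root N (k j) = 0" by simp
  then have "card ?J = 0" by simp
  then show False using I j by auto
qed

section \<open>Counting eigenvalue tuples\<close>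

lemma torus_mu_eq_unity_root_sum:
  "complex_of_real (torus_mu N d k) = (\<Sum>j=1..d. unity_root N (k j) + unity_root N (- k j))"
proof -
  have "unity_root N (k j) + unity_root N (- k j) = of_real (2 * cos (2 * real_of_int (k j) * pi / real N))" for j
    by (simp add: unity_root_def complex_eq_iff mult_ac)
  then show ?thesis by (simp add: torus_mu_def sum_distrib_left)
qed

text \<open>The class of \<open>L * k j\<close> in the relation between \<open>k\<close> and
  \<open>l\<close> is a vanishing sum with all coefficients 1, so some prime factor of
  \<open>N\<close> is at most its number of terms. It remains to count coordinates instead of
  terms.\<close>

lemma prime_le_card_class_of_free_exponent:
  fixes k l :: "nat \<Rightarrow> int" and L :: int
  assumes N: "N > 0" and mu: "torus_mu N d k = torus_mu N d l" and L: "fact (4 * d) dvd L"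
    and j: "j \<in> {1..d}" and nonself: "\<not> [L * k j = - (L * k j)] (mod int N)"
    and free: "\<And>i. i \<in> {1..d} \<Longrightarrow>
      \<not> [L * k j = L * l i] (mod int N) \<and> \<not> [L * k j = - (L * l i)] (mod int N)"
  shows "\<exists>p. prime p \<and> p dvd N \<and>
    p \<le> card {i\<in>{1..d}. [L * k i = L * k j] (mod int N) \<or> [L * k i = - (L * k j)] (mod int N)}"
proof -
  \<comment> \<open>A triple \<open>(b, s, i)\<close> names one of the \<open>4 * d\<close> terms:
    \<open>b\<close> selects \<open>k\<close> or \<open>l\<close>, \<open>s\<close> the sign of the
    exponent, \<open>i\<close> the coordinate.\<close>
  define I :: "(bool \<times> bool \<times> nat) set" where "I = UNIV \<times> UNIV \<times> {1..d}"
  define e where "e = (\<lambda>(b, s, i). (if s then 1 else - 1) * (if b then k i else l i))"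
  define c :: "bool \<times> bool \<times> nat \<Rightarrow> int" where "c = (\<lambda>(b, s, i). if b then 1 else - 1)"
  define J where "J = {x\<in>I. [L * e x = L * k j] (mod int N)}"
  have fin: "finite I" by (simp add: I_def)
  have "(\<Sum>x\<in>I. of_int (c x) * unity_root N (e x))
      = complex_of_real (torus_mu N d k) - complex_of_real (torus_mu N d l)"
  proof -
    have "sum g I = (\<Sum>b\<in>UNIV. \<Sum>s\<in>UNIV. \<Sum>i\<in>{1..d}. g (b, s, i))"
      for g :: "bool \<times> bool \<times> nat \<Rightarrow> complex"
      unfolding I_def by (simp add: sum.cartesian_product split_beta)
    then show ?thesis unfolding torus_mu_eq_unity_root_sum
      by (simp add: UNIV_bool c_def e_def sum.distrib sum_negf)
  qed
  then have sum0: "(\<Sum>x\<in>I. of_int (c x) * unity_root N (e x)) = 0" by (simp add: mu)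
  have "\<bar>c x\<bar> = 1" for x by (auto simp: c_def split: prod.splits)
  then have "(\<Sum>x\<in>I. \<bar>c x\<bar>) \<le> int (4 * d)" by (simp add: I_def card_cartesian_product)
  from unity_root_sum_scaled_class[OF L N fin sum0 this, of "L * k j"]
  have "(\<Sum>x\<in>J. of_int (c x) * unity_root N (e x)) = 0" by (simp add: J_def)
  \<comment> \<open>By \<open>free\<close>, no term coming from \<open>l\<close> lies in the
    class.\<close>
  moreover have J_k: "fst x" if "x \<in> J" for x
    using that free by (auto simp: J_def I_def e_def cong_sym_eq split: if_splits prod.splits)
  then have "c x = 1" if "x \<in> J" for x using that by (auto simp: c_def split: prod.splits)
  ultimately have sumJ: "(\<Sum>x\<in>J. unity_root N (e x)) = 0" by simp
  have "finite J" using fin by (simp add: J_def)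
  moreover have "(True, True, j) \<in> J" using j by (simp add: J_def I_def e_def)
  ultimately obtain p where p: "prime p" "p dvd N" "p \<le> card J"
    using unity_root_sum_eq_0_imp_prime_le_card[OF N _ _ sumJ] by blast
  have cls: "[L * k i = (if s then 1 else - 1) * (L * k j)] (mod int N)" if "(b, s, i) \<in> J" for b s i
  proof -
    have "[L * ((if s then 1 else - 1) * k i) = L * k j] (mod int N)"
      using that J_k[OF that] by (auto simp: J_def e_def)
    then show ?thesis using cong_minus_minus_iff[of "L * k i" "- (L * k j)"] by (cases s) auto
  qed
  \<comment> \<open>By \<open>nonself\<close>, the terms with exponents \<open>k i\<close> and
    \<open>- k i\<close> are never both in the class, so each coordinate is met at most
    once.\<close>
  have "inj_on (\<lambda>(b, s, i). i) J"
  proof (rule inj_onI, unfold split_paired_all prod.case)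
    fix b s i b' s' i'
    assume x: "(b, s, i) \<in> J" and y': "(b', s', i') \<in> J" and i: "i = i'"
    have y: "(b', s', i) \<in> J" using y' i by simp
    have "s = s'"
    proof (rule ccontr)
      assume "s \<noteq> s'"
      then have "[L * k i = L * k j] (mod int N)" "[L * k i = - (L * k j)] (mod int N)"
        using cls[OF x] cls[OF y] by (cases s; simp)+
      then show False using nonself cong_sym cong_trans by blast
    qed
    then show "(b, s, i) = (b', s', i')" using i J_k[OF x] J_k[OF y] by simp
  qed
  moreover have "(\<lambda>(b, s, i). i) ` J \<subseteq>
      {i\<in>{1..d}. [L * k i = L * k j] (mod int N) \<or> [L * k i = - (L * k j)] (mod int N)}"
  proof (rule image_subsetI, unfold split_paired_all prod.case)
    fix b s i assume x: "(b, s, i) \<in> J"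
    then have "i \<in> {1..d}" by (simp add: J_def I_def)
    then show "i \<in> {i\<in>{1..d}. [L * k i = L * k j] (mod int N) \<or> [L * k i = - (L * k j)] (mod int N)}"
      using cls[OF x] by (cases s) simp_all
  qed
  ultimately have "card J \<le>
      card {i\<in>{1..d}. [L * k i = L * k j] (mod int N) \<or> [L * k i = - (L * k j)] (mod int N)}"
    by (intro card_inj_on_le) auto
  then show ?thesis using p by (meson le_trans)
qed

text \<open>\<open>B\<close> contains one index from each class, up to sign, of free exponents.
  These classes are disjoint and have at least \<open>q\<close> indices each, whence
  \<open>q * card B \<le> d\<close>. The factor 2 and the value 0 account for exponents with
  \<open>L * k j\<close> congruent to its negative, for which only \<open>2 * L * k j\<close> is
  known to vanish.\<close>

lemma torus_mu_eq_base_exponents: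
  fixes k l :: "nat \<Rightarrow> int"
  assumes N: "N > 0" and mu: "torus_mu N d k = torus_mu N d l"
    and q: "\<And>p. prime p \<Longrightarrow> p dvd N \<Longrightarrow> q \<le> p"
  defines "L \<equiv> fact (4 * d)"
  shows "\<exists>B\<subseteq>{1..d}. q * card B \<le> d \<and> (\<forall>j\<in>{1..d}. \<exists>y\<in>k ` B \<union> (l ` {1..d} \<union> {0}).
    [2 * L * k j = 2 * L * y] (mod int N) \<or> [2 * L * k j = - (2 * L * y)] (mod int N))"
proof -
  define F where "F = {j\<in>{1..d}. \<not> [L * k j = - (L * k j)] (mod int N) \<and> (\<forall>i\<in>{1..d}.
      \<not> [L * k j = L * l i] (mod int N) \<and> \<not> [L * k j = - (L * l i)] (mod int N))}"
  \<comment> \<open>An unordered pair of residues encodes the class up to sign.\<close>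
  define cl where "cl j = {L * k j mod int N, (- (L * k j)) mod int N}" for j
  have cl_eq: "cl i = cl j \<longleftrightarrow> [L * k i = L * k j] (mod int N) \<or> [L * k i = - (L * k j)] (mod int N)" for i j
  proof -
    have "[- (L * k i) = - (L * k j)] (mod int N) \<longleftrightarrow> [L * k i = L * k j] (mod int N)"
      "[- (L * k i) = L * k j] (mod int N) \<longleftrightarrow> [L * k i = - (L * k j)] (mod int N)"
      using cong_minus_minus_iff[of "L * k i" "L * k j"] cong_minus_minus_iff[of "L * k i" "- (L * k j)"]
      by simp_all
    then show ?thesis unfolding cl_def doubleton_eq_iff by (auto simp: cong_def)
  qed
  define B where "B = inv_into F cl ` cl ` F"
  have finF: "finite F" by (simp add: F_def)
  have BF: "B \<subseteq> F" unfolding B_def by (auto intro: inv_into_into)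
  have big: "q \<le> card {i\<in>{1..d}. cl i = cl j}" if "j \<in> F" for j
  proof -
    have "\<exists>p. prime p \<and> p dvd N \<and> p \<le> card {i\<in>{1..d}. cl i = cl j}"
      unfolding cl_eq by (rule prime_le_card_class_of_free_exponent[OF N mu])
        (use that in \<open>auto simp: F_def L_def\<close>)
    then show ?thesis using q le_trans by blast
  qed
  have "q * card B \<le> q * card (cl ` F)"
    unfolding B_def using finF by (intro mult_left_mono card_image_le) auto
  also have "\<dots> = (\<Sum>v\<in>cl ` F. q)" by simp
  also have "\<dots> \<le> (\<Sum>v\<in>cl ` F. card {i\<in>{1..d}. cl i = v})"
    using big by (intro sum_mono) auto
  also have "\<dots> \<le> (\<Sum>v\<in>cl ` {1..d}. card {i\<in>{1..d}. cl i = v})"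
    by (intro sum_mono2) (auto simp: F_def)
  also have "\<dots> = card {1..d}"
    using sum.group[of "{1..d}" "cl ` {1..d}" cl "\<lambda>_. 1 :: nat"] by simp
  finally have card: "q * card B \<le> d" by simp
  have double: "[2 * L * a = 2 * L * b] (mod int N)" if "[L * a = L * b] (mod int N)" for a b
    using cong_scalar_left[OF that, of 2] by (simp add: mult.assoc)
  have double': "[2 * L * a = - (2 * L * b)] (mod int N)" if "[L * a = - (L * b)] (mod int N)" for a b
    using cong_scalar_left[OF that, of 2] by (simp add: mult.assoc)
  have "\<exists>y\<in>k ` B \<union> (l ` {1..d} \<union> {0}).
      [2 * L * k j = 2 * L * y] (mod int N) \<or> [2 * L * k j = - (2 * L * y)] (mod int N)"
    if j: "j \<in> {1..d}" for j
  proof (cases "j \<in> F")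
    case True
    define b where "b = inv_into F cl (cl j)"
    have "b \<in> B" using True by (auto simp: b_def B_def)
    moreover have "cl j = cl b" using True by (simp add: b_def f_inv_into_f)
    ultimately show ?thesis using double double' cl_eq by blast
  next
    case False
    then consider "[L * k j = - (L * k j)] (mod int N)"
      | i where "i \<in> {1..d}" "[L * k j = L * l i] (mod int N) \<or> [L * k j = - (L * l i)] (mod int N)"
      using j by (auto simp: F_def)
    then show ?thesis
    proof cases
      case 1
      then have "[2 * L * k j = 2 * L * 0] (mod int N)"
        by (simp add: cong_iff_dvd_diff algebra_simps)
      then show ?thesis by blast
    next
      case 2
      then show ?thesis using double double' by blast
    qed
  qed
  then show ?thesis using BF card by (intro exI[of _ B]) (auto simp: F_def)
qed

section \<open>Counting the solutions\<close>

text \<open>The products \<open>M * u\<close> lie in an interval of length \<open>M * N\<close> and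
  share one residue modulo \<open>N\<close>, so the quotient by \<open>N\<close>, which takes at
  most \<open>M\<close> values, determines \<open>u\<close>.\<close>

lemma card_linear_congruence_le:
  fixes v :: int
  assumes N: "N > 0" and M: "M > 0"
  shows "card {u\<in>{0..<int N}. [int M * u = v] (mod int N)} \<le> M"
proof -
  let ?U = "{u\<in>{0..<int N}. [int M * u = v] (mod int N)}"
  have "inj_on (\<lambda>u. (int M * u) div int N) ?U"
  proof (rule inj_onI)
    fix x y assume xy: "x \<in> ?U" "y \<in> ?U" "(int M * x) div int N = (int M * y) div int N"
    then have "(int M * x) mod int N = (int M * y) mod int N" by (simp add: cong_def)
    then have "int M * x = int M * y" using xy(3) by (metis mult_div_mod_eq)
    then show "x = y" using M by simp
  qed
  moreover have "(\<lambda>u. (int M * u) div int N) ` ?U \<subseteq> {0..<int M}"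
  proof (rule image_subsetI)
    fix u assume u: "u \<in> ?U"
    have "int M * u < int M * int N" using u M by simp
    moreover have "(int M * u) div int N * int N \<le> int M * u"
      using N div_mult_mod_eq[of "int M * u" "int N"]
        pos_mod_sign[of "int N" "int M * u"] by linarith
    ultimately have "(int M * u) div int N * int N < int M * int N" by linarith
    then have "(int M * u) div int N < int M" using N by simp
    then show "(int M * u) div int N \<in> {0..<int M}" using u N M by (simp add: pos_imp_zdiv_nonneg_iff)
  qed
  ultimately have "card ?U \<le> card {0..<int M}" by (intro card_inj_on_le) auto
  then show ?thesis by simp
qed

lemma carrier_torus_group:
  "N > 0 \<Longrightarrow> carrier (torus_group N d) = (\<Pi>\<^sub>E j\<in>{1..d}. {0..<int N})"
  by (simp add: torus_group_def carrier_integer_mod_group)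

text \<open>There are at most \<open>2 ^ d\<close> choices of the base set \<open>B\<close> and
  \<open>N ^ (d div q)\<close> choices of the exponents on it; after that each coordinate has a
  number of values bounded in terms of \<open>d\<close>.\<close>

lemma torus_multiplicity_le:
  assumes N: "N > 0" and q: "q > 0" "\<And>p. prime p \<Longrightarrow> p dvd N \<Longrightarrow> q \<le> p"
  shows "torus_multiplicity N d \<mu> \<le>
    2 ^ d * N ^ (d div q) * ((2 * d + 1) * (4 * fact (4 * d))) ^ d"
proof (cases "\<exists>l\<in>carrier (torus_group N d). torus_mu N d l = \<mu>")
  case False
  then have "{k \<in> carrier (torus_group N d). torus_mu N d k = \<mu>} = {}" by blast
  then show ?thesis by (simp only: torus_multiplicity_def card.empty)
next
  case True
  then obtain l where l: "torus_mu N d l = \<mu>" by blast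
  define L :: int where "L = fact (4 * d)"
  define M :: nat where "M = 2 * fact (4 * d)"
  \<comment> \<open>At most \<open>2 * d + 1\<close> values in \<open>Y\<close>, two signs, and
    \<open>M\<close> solutions of each congruence.\<close>
  define K where "K = (2 * d + 1) * (4 * fact (4 * d :: nat) :: nat)"
  have M: "M > 0" "2 * L = int M" by (simp_all add: M_def L_def)
  define Y where "Y w B = w ` B \<union> (l ` {1..d} \<union> {0})" for w :: "nat \<Rightarrow> int" and B
  define T where "T w B = {u\<in>{0..<int N}. \<exists>y\<in>Y w B.
      [2 * L * u = 2 * L * y] (mod int N) \<or> [2 * L * u = - (2 * L * y)] (mod int N)}" for w B
  define \<B> where "\<B> = {B\<in>Pow {1..d}. q * card B \<le> d}"
  define W where "W B = (\<Pi>\<^sub>E j\<in>B. {0..<int N})" for B :: "nat set"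
  define S where "S = {k \<in> carrier (torus_group N d). torus_mu N d k = \<mu>}"
  have finB: "finite \<B>" "\<And>B. B \<in> \<B> \<Longrightarrow> finite B"
    by (auto simp: \<B>_def intro: finite_subset)
  have finW: "finite (W B)" if "B \<in> \<B>" for B
    unfolding W_def using finB(2)[OF that] by (intro finite_PiE) auto
  have finT: "finite (T w B)" for w B
    by (rule finite_subset[of _ "{0..<int N}"]) (auto simp: T_def)
  have cover: "S \<subseteq> (\<Union>B\<in>\<B>. \<Union>w\<in>W B. \<Pi>\<^sub>E j\<in>{1..d}. T w B)"
  proof
    fix k assume "k \<in> S"
    then have k: "k \<in> (\<Pi>\<^sub>E j\<in>{1..d}. {0..<int N})" "torus_mu N d k = torus_mu N d l"
      by (simp_all add: S_def l carrier_torus_group[OF N])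
    obtain B where B: "B \<subseteq> {1..d}" "q * card B \<le> d" "\<forall>j\<in>{1..d}. \<exists>y\<in>Y k B.
        [2 * L * k j = 2 * L * y] (mod int N) \<or> [2 * L * k j = - (2 * L * y)] (mod int N)"
      using torus_mu_eq_base_exponents[OF N k(2) q(2)] unfolding L_def Y_def by blast
    \<comment> \<open>Restriction makes the base exponents an element of the finite extensional
      function space \<open>W B\<close>.\<close>
    define w where "w = restrict k B"
    have "Y w B = Y k B" by (simp add: Y_def w_def)
    then have "k j \<in> T w B" if "j \<in> {1..d}" for j
      using B(3) that PiE_mem[OF k(1) that] by (simp add: T_def)
    then have "k \<in> (\<Pi>\<^sub>E j\<in>{1..d}. T w B)" using PiE_arb[OF k(1)] by (intro PiE_I) auto
    moreover have "w \<in> W B" using k(1) B(1) by (auto simp: W_def w_def)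
    moreover have "B \<in> \<B>" using B by (simp add: \<B>_def)
    ultimately show "k \<in> (\<Union>B\<in>\<B>. \<Union>w\<in>W B. \<Pi>\<^sub>E j\<in>{1..d}. T w B)" by blast
  qed
  have cardT: "card (T w B) \<le> K" if B: "B \<in> \<B>" for w B
  proof -
    let ?V = "\<lambda>v. {u\<in>{0..<int N}. [int M * u = v] (mod int N)}"
    have finY: "finite (Y w B)" using finB(2)[OF B] by (simp add: Y_def)
    have "card B \<le> card {1..d}" using B by (intro card_mono) (auto simp: \<B>_def)
    then have "card (w ` B) \<le> d" using card_image_le[OF finB(2)[OF B], of w] by simp
    moreover have "card (l ` {1..d}) \<le> d" using card_image_le[of "{1..d}" l] by simp
    moreover have "card (Y w B) \<le> card (w ` B) + (card (l ` {1..d}) + card {0::int})"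
      unfolding Y_def by (meson card_Un_le add_left_mono le_trans)
    ultimately have cardY: "card (Y w B) \<le> 2 * d + 1" by simp
    have T_eq: "T w B = (\<Union>y\<in>Y w B. ?V (2 * L * y) \<union> ?V (- (2 * L * y)))"
      unfolding T_def M(2) by auto
    have "card (T w B) \<le> (\<Sum>y\<in>Y w B. card (?V (2 * L * y) \<union> ?V (- (2 * L * y))))"
      unfolding T_eq by (rule card_UN_le[OF finY])
    also have "\<dots> \<le> (\<Sum>y\<in>Y w B. M + M)"
    proof (rule sum_mono)
      fix y
      show "card (?V (2 * L * y) \<union> ?V (- (2 * L * y))) \<le> M + M"
        by (rule order_trans[OF card_Un_le add_mono]) (rule card_linear_congruence_le[OF N M(1)])+
    qed
    also have "\<dots> = card (Y w B) * (M + M)" by simp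
    also have "\<dots> \<le> (2 * d + 1) * (M + M)" using cardY by (rule mult_right_mono) simp
    finally show ?thesis by (simp add: K_def M_def mult_ac)
  qed
  have "card S \<le> card (\<Union>B\<in>\<B>. \<Union>w\<in>W B. \<Pi>\<^sub>E j\<in>{1..d}. T w B)"
    using cover finB finW finT by (intro card_mono finite_UN_I finite_PiE) auto
  also have "\<dots> \<le> (\<Sum>B\<in>\<B>. card (\<Union>w\<in>W B. \<Pi>\<^sub>E j\<in>{1..d}. T w B))"
    by (rule card_UN_le[OF finB(1)])
  also have "\<dots> \<le> (\<Sum>B\<in>\<B>. N ^ (d div q) * K ^ d)"
  proof (rule sum_mono)
    fix B assume B: "B \<in> \<B>"
    have "card (\<Union>w\<in>W B. \<Pi>\<^sub>E j\<in>{1..d}. T w B) \<le> (\<Sum>w\<in>W B. card (\<Pi>\<^sub>E j\<in>{1..d}. T w B))"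
      by (rule card_UN_le[OF finW[OF B]])
    also have "\<dots> \<le> (\<Sum>w\<in>W B. K ^ d)"
      using cardT[OF B] by (intro sum_mono) (simp add: card_PiE power_mono)
    also have "\<dots> = N ^ card B * K ^ d" using finB(2)[OF B] by (simp add: W_def card_PiE)
    also have "card B \<le> d div q" using B q(1)
      by (simp add: \<B>_def less_eq_div_iff_mult_less_eq mult.commute)
    then have "N ^ card B * K ^ d \<le> N ^ (d div q) * K ^ d"
      using N by (intro mult_right_mono power_increasing) auto
    finally show "card (\<Union>w\<in>W B. \<Pi>\<^sub>E j\<in>{1..d}. T w B) \<le> N ^ (d div q) * K ^ d" .
  qed
  also have "\<dots> = card \<B> * (N ^ (d div q) * K ^ d)" by simp
  also have "card \<B> \<le> card (Pow {1..d})" by (intro card_mono) (auto simp: \<B>_def)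
  then have "card \<B> * (N ^ (d div q) * K ^ d) \<le> 2 ^ d * (N ^ (d div q) * K ^ d)"
    by (intro mult_right_mono) (auto simp: card_Pow)
  finally show ?thesis by (simp only: S_def torus_multiplicity_def K_def mult.assoc)
qed

theorem theorem4:
  fixes d :: nat
  assumes "d \<ge> 1"
  shows "\<exists>C::real. \<forall>N::nat. N \<ge> 3 \<longrightarrow>
    (\<forall>\<mu>::real. eigenvalue (torus_adjacency N d) \<mu> \<longrightarrow>
      real (torus_multiplicity N d \<mu>)
        \<le> C * real N powr (real d / real (LEAST p::nat. prime p \<and> p dvd N)) \<and>
      real (torus_multiplicity N d \<mu>) \<le> C * real N powr (real d / 2))"
proof -
  \<comment> \<open>The factors of the bound in \<open>torus_multiplicity_le\<close> that depend on
    \<open>d\<close> alone.\<close>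
  define C :: nat where "C = 2 ^ d * ((2 * d + 1) * (4 * fact (4 * d))) ^ d"
  have bound: "real (torus_multiplicity N d \<mu>)
        \<le> C * real N powr (real d / real (LEAST p::nat. prime p \<and> p dvd N)) \<and>
      real (torus_multiplicity N d \<mu>) \<le> C * real N powr (real d / 2)"
    if N: "N \<ge> 3" for N \<mu>
  proof -
    define q where "q = (LEAST p::nat. prime p \<and> p dvd N)"
    obtain p where "prime p" "p dvd N" using prime_factor_nat[of N] N by auto
    then have "prime q \<and> q dvd N" 
      unfolding q_def using LeastI[of "\<lambda>p. prime p \<and> p dvd N" p] by blast
    then have q: "q \<ge> 2" using prime_ge_2_nat by blast
    have "q \<le> p" if "prime p" "p dvd N" for p
      unfolding q_def using that Least_le[of "\<lambda>p. prime p \<and> p dvd N" p] by blast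
    then have "torus_multiplicity N d \<mu> \<le> C * N ^ (d div q)"
      using torus_multiplicity_le[of N q d \<mu>] N q by (simp add: C_def mult_ac)
    then have "real (torus_multiplicity N d \<mu>) \<le> real (C * N ^ (d div q))"
      by (simp only: of_nat_le_iff)
    also have "\<dots> = C * real N powr real (d div q)" using N by (simp add: powr_realpow)
    also have "\<dots> \<le> C * real N powr (real d / real q)"
      using N by (intro mult_left_mono powr_mono of_nat_div_le_of_nat) auto
    finally have 1: "real (torus_multiplicity N d \<mu>) \<le> C * real N powr (real d / real q)" .
    \<comment> \<open>The smallest prime factor is at least 2.\<close>
    also have "\<dots> \<le> C * real N powr (real d / 2)"
      using N q by (intro mult_left_mono powr_mono divide_left_mono) auto
    finally show ?thesis using 1 by (simp add: q_def)
  qed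
  then show ?thesis by blast
qed

end
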